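(* $\overline{\alpha}(K_n) = \Omega(\log\log n)$; that is, there is a constant $c>0$ such that for all sufficiently large $n$, every edge-ordered geometric graph isomorphic to $K_n$ contains a non-crossing monotone path of length at least $c\log\log n$.
   Context: A geometric graph is a graph whose vertices are points in the plane in general position and whose edges are straight line segments joining these points; a straight-line drawing of a graph $G$ is a geometric graph isomorphic to $G$. An edge-ordering is a total order on the edges. In an edge-ordered graph, a path $v_1v_2\ldots v_k$ is increasing if $(v_iv_{i+1}) > (v_{i+1}v_{i+2})$ for all $i=1,\ldots,k-2$, decreasing if $(v_iv_{i+1}) < (v_{i+1}v_{i+2})$ for all $i$, and monotone if it is increasing or decreasing. Its length is its number of edges. A path in a geometric graph is non-crossing if no two of its edges cross. For a geometric graph $\widetilde G$, $\overline\alpha(\widetilde G)$ is the minimum, over all edge-orderings of $\widetilde G$, of the maximum length of a non-crossing monotone path in $\widetilde G$; $\overline\alpha(G)$ is the minimum of $\overline\alpha(\widetilde G)$ over all straight-line drawings $\widetilde G$ of $G$. *)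

theory Defs
  imports "HOL-Analysis.Analysis" "HOL-Library.Landau_Symbols"
begin

record 'a graph =
  verts :: "'a set"
  edges :: "'a set set"

definition simple_graph :: "'a graph \<Rightarrow> bool" where
  "simple_graph G \<longleftrightarrow> finite (verts G) \<and> (\<forall>e\<in>edges G. e \<subseteq> verts G \<and> card e = 2)"

definition complete_graph :: "nat \<Rightarrow> nat graph" where
  "complete_graph n = \<lparr>verts = {..<n}, edges = {e. e \<subseteq> {..<n} \<and> card e = 2}\<rparr>"

definition graph_isomorphic :: "'a graph \<Rightarrow> 'b graph \<Rightarrow> bool" where
  "graph_isomorphic G H \<longleftrightarrow>
     (\<exists>f. bij_betw f (verts G) (verts H) \<and>
          (\<forall>u\<in>verts G. \<forall>v\<in>verts G. {u, v} \<in> edges G \<longleftrightarrow> {f u, f v} \<in> edges H))"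

type_synonym point = "real ^ 2"

definition general_position :: "point set \<Rightarrow> bool" where
  "general_position S \<longleftrightarrow>
     (\<forall>x\<in>S. \<forall>y\<in>S. \<forall>z\<in>S. x \<noteq> y \<and> y \<noteq> z \<and> x \<noteq> z \<longrightarrow> \<not> collinear {x, y, z})"

text \<open>An edge \<open>{x, y}\<close> of a geometric graph stands for the closed segment from \<open>x\<close> to \<open>y\<close>.\<close>

definition geometric_graph :: "point graph \<Rightarrow> bool" where
  "geometric_graph G \<longleftrightarrow> simple_graph G \<and> general_position (verts G)"

definition straight_line_drawing :: "point graph \<Rightarrow> 'a graph \<Rightarrow> bool" where
  "straight_line_drawing D G \<longleftrightarrow> geometric_graph D \<and> graph_isomorphic D G"

text \<open>Two edges cross if they meet in a point interior to both; edges that merely share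
  an endpoint do not cross.\<close>

definition edges_cross :: "point set \<Rightarrow> point set \<Rightarrow> bool" where
  "edges_cross e f \<longleftrightarrow> e \<noteq> f \<and>
     (\<exists>a b c d. e = {a, b} \<and> f = {c, d} \<and> open_segment a b \<inter> open_segment c d \<noteq> {})"

text \<open>The pair \<open>(e, f) \<in> r\<close> means \<open>e \<le> f\<close>.\<close>

definition edge_ordering :: "'a graph \<Rightarrow> ('a set \<times> 'a set) set \<Rightarrow> bool" where
  "edge_ordering G r \<longleftrightarrow> linear_order_on (edges G) r"

definition path_edge :: "'a list \<Rightarrow> nat \<Rightarrow> 'a set" where
  "path_edge p i = {p ! i, p ! Suc i}"

text \<open>Paths do not repeat vertices; a single vertex is a path of length \<open>0\<close>.\<close>

definition is_path :: "'a graph \<Rightarrow> 'a list \<Rightarrow> bool" where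
  "is_path G p \<longleftrightarrow> p \<noteq> [] \<and> distinct p \<and> set p \<subseteq> verts G \<and>
     (\<forall>i. Suc i < length p \<longrightarrow> path_edge p i \<in> edges G)"

definition path_length :: "'a list \<Rightarrow> nat" where
  "path_length p = length p - 1"

text \<open>Along an increasing path the edges get smaller, and along a decreasing path they get
  larger.  This is deliberate, and immaterial for monotone paths.\<close>

definition increasing_path :: "('a set \<times> 'a set) set \<Rightarrow> 'a list \<Rightarrow> bool" where
  "increasing_path r p \<longleftrightarrow>
     (\<forall>i. Suc (Suc i) < length p \<longrightarrow> (path_edge p (Suc i), path_edge p i) \<in> r - Id)"

definition decreasing_path :: "('a set \<times> 'a set) set \<Rightarrow> 'a list \<Rightarrow> bool" where
  "decreasing_path r p \<longleftrightarrow>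
     (\<forall>i. Suc (Suc i) < length p \<longrightarrow> (path_edge p i, path_edge p (Suc i)) \<in> r - Id)"

definition monotone_path :: "('a set \<times> 'a set) set \<Rightarrow> 'a list \<Rightarrow> bool" where
  "monotone_path r p \<longleftrightarrow> increasing_path r p \<or> decreasing_path r p"

definition noncrossing_path :: "point list \<Rightarrow> bool" where
  "noncrossing_path p \<longleftrightarrow>
     (\<forall>i j. Suc i < length p \<and> Suc j < length p \<longrightarrow>
        \<not> edges_cross (path_edge p i) (path_edge p j))"

definition noncrossing_monotone_path ::
  "point graph \<Rightarrow> (point set \<times> point set) set \<Rightarrow> point list \<Rightarrow> bool" where
  "noncrossing_monotone_path G r p \<longleftrightarrow> is_path G p \<and> monotone_path r p \<and> noncrossing_path p"

text \<open>The set under \<open>Max\<close> is finite if \<open>G\<close> is a geometric graph, and nonempty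
  as soon as \<open>G\<close> has a vertex.  The infimum of a nonempty set of natural numbers is its
  minimum.\<close>

definition max_noncrossing_monotone_length ::
  "point graph \<Rightarrow> (point set \<times> point set) set \<Rightarrow> nat" where
  "max_noncrossing_monotone_length G r = Max {path_length p | p. noncrossing_monotone_path G r p}"

definition alpha_bar_geometric :: "point graph \<Rightarrow> nat" where
  "alpha_bar_geometric G = Inf {max_noncrossing_monotone_length G r | r. edge_ordering G r}"

definition alpha_bar :: "'a graph \<Rightarrow> nat" where
  "alpha_bar G = Inf {alpha_bar_geometric D | D. straight_line_drawing D G}"

end

theory Submission
  imports Defs "HOL-Real_Asymp.Real_Asymp"
begin

text \<open>
  A path whose vertices are sorted lexicographically by their coordinates is non-crossing, so it
  suffices to find a long monotone path among the sorted ones. Give an edge \<open>{u, v}\<close> with \<open>u\<close> before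
  \<open>v\<close> the pair of maximal lengths of the sorted decreasing and of the sorted increasing paths that
  end with \<open>u, v\<close>. Consecutive edges \<open>{u, v}\<close>, \<open>{v, w}\<close> of a sorted path get different pairs, since
  one of the two maxima can be prolonged by \<open>w\<close>. Hence the set of pairs of the edges that end in
  \<open>v\<close> determines \<open>v\<close>, and if sorted monotone paths have at most \<open>k\<close> vertices, then there are at
  most \<open>2 ^ k\<^sup>2\<close> vertices in total. This even gives length of order \<open>sqrt (ln n)\<close>.
\<close>

section \<open>Longest sorted monotone paths and the counting bound\<close>

text \<open>Lets everything be proved for decreasing paths and then be applied to both
  \<open>r\<close> and \<open>r\<inverse>\<close>.\<close>

lemma increasing_path_conv_decreasing:
  "increasing_path r p \<longleftrightarrow> decreasing_path (r\<inverse>) p"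
  by (auto simp: increasing_path_def decreasing_path_def)

lemma decreasing_path_snoc:
  assumes "decreasing_path r (q @ [u, v])" and "({u, v}, {v, w}) \<in> r - Id"
  shows "decreasing_path r (q @ [u, v, w])"
  unfolding decreasing_path_def
proof (intro allI impI)
  fix i
  assume i: "Suc (Suc i) < length (q @ [u, v, w])"
  show "(path_edge (q @ [u, v, w]) i, path_edge (q @ [u, v, w]) (Suc i)) \<in> r - Id"
  proof (cases "i = length q")
    case True
    then show ?thesis using assms(2) by (simp add: path_edge_def nth_append)
  next
    case False
    with i have less: "Suc (Suc i) < length (q @ [u, v])" by auto
    have eq: "(q @ [u, v, w]) ! j = (q @ [u, v]) ! j" if "j < length (q @ [u, v])" for j
      using that nth_append[of "q @ [u, v]" "[w]" j] by simp
    show ?thesis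
      using assms(1) less unfolding decreasing_path_def path_edge_def by (simp add: eq)
  qed
qed

text \<open>Edge membership is left out because in a complete graph any two distinct vertices span
  an edge. The empty list counts as well.\<close>

definition sorted_decreasing_path ::
  "('a \<Rightarrow> 'a \<Rightarrow> bool) \<Rightarrow> 'a set \<Rightarrow> ('a set \<times> 'a set) set \<Rightarrow> 'a list \<Rightarrow> bool" where
  "sorted_decreasing_path lt V r p \<longleftrightarrow>
     sorted_wrt lt p \<and> set p \<subseteq> V \<and> decreasing_path r p"

text \<open>Counts vertices rather than edges. The form \<open>q @ [u, v]\<close> exposes the last
  edge, which is the one to be coloured.\<close>

definition longest_ending ::
  "('a \<Rightarrow> 'a \<Rightarrow> bool) \<Rightarrow> 'a set \<Rightarrow> ('a set \<times> 'a set) set \<Rightarrow> 'a \<Rightarrow> 'a \<Rightarrow> nat" where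
  "longest_ending lt V r u v =
     Max {length (q @ [u, v]) | q. sorted_decreasing_path lt V r (q @ [u, v])}"

context
  fixes lt :: "'a \<Rightarrow> 'a \<Rightarrow> bool" and V :: "'a set" and r :: "('a set \<times> 'a set) set" and K :: nat
  assumes bounded: "\<And>p. sorted_decreasing_path lt V r p \<Longrightarrow> length p \<le> K"
begin

lemma finite_ending: "finite {length (q @ [u, v]) | q. sorted_decreasing_path lt V r (q @ [u, v])}"
  by (rule finite_subset[of _ "{..K}"]) (auto dest: bounded)

lemma longest_ending_attained:
  assumes "u \<in> V" "v \<in> V" "lt u v"
  obtains q where "sorted_decreasing_path lt V r (q @ [u, v])"
    and "longest_ending lt V r u v = length (q @ [u, v])"
proof -
  have "sorted_decreasing_path lt V r ([] @ [u, v])"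
    using assms by (simp add: sorted_decreasing_path_def decreasing_path_def)
  then have "{length (q @ [u, v]) | q. sorted_decreasing_path lt V r (q @ [u, v])} \<noteq> {}"
    by blast
  from Max_in[OF finite_ending this] show ?thesis
    using that unfolding longest_ending_def by blast
qed

text \<open>Makes the number of possible colours of an edge at most
  \<open>K\<^sup>2\<close>.\<close>

lemma longest_ending_bounds:
  assumes "u \<in> V" "v \<in> V" "lt u v"
  shows "longest_ending lt V r u v \<in> {1..K}"
  using longest_ending_attained[OF assms] bounded
  by (metis One_nat_def Suc_leI atLeastAtMost_iff length_greater_0_conv snoc_eq_iff_butlast
      append_is_Nil_conv list.distinct(1))

text \<open>A longest path that ends with \<open>u, v\<close> can be prolonged by \<open>w\<close>:
  the edge order allows it, and transitivity of \<open>lt\<close> puts all earlier vertices before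
  \<open>w\<close>.\<close>

lemma longest_ending_less:
  assumes "transp lt" "u \<in> V" "v \<in> V" "w \<in> V" "lt u v" "lt v w"
    and "({u, v}, {v, w}) \<in> r - Id"
  shows "longest_ending lt V r u v < longest_ending lt V r v w"
proof -
  obtain q where q: "sorted_decreasing_path lt V r (q @ [u, v])"
    and len: "longest_ending lt V r u v = length (q @ [u, v])"
    using longest_ending_attained[OF assms(2,3,5)] .
  have "sorted_wrt lt (q @ [u, v, w])"
    using q assms(1,5,6)
    by (auto simp: sorted_decreasing_path_def sorted_wrt_append dest: transpD)
  with q assms(4) decreasing_path_snoc[OF _ assms(7)]
  \<comment> \<open>The regrouping shows the prolonged path as a candidate in the maximum for
    \<open>v\<close> and \<open>w\<close>.\<close>
  have "sorted_decreasing_path lt V r ((q @ [u]) @ [v, w])"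
    by (auto simp: sorted_decreasing_path_def)
  then have "length ((q @ [u]) @ [v, w]) \<le> longest_ending lt V r v w"
    unfolding longest_ending_def by (intro Max_ge finite_ending) blast
  with len show ?thesis by simp
qed

end

text \<open>The pairs of maxima properly colour the shift graph, in which \<open>(u, v)\<close> is
  adjacent to \<open>(v, w)\<close>. A proper colouring with \<open>c\<close> colours allows at most
  \<open>2 ^ c\<close> vertices in \<open>V\<close>, and here \<open>c\<close> is at most
  \<open>K\<^sup>2\<close>.\<close>

lemma card_le_of_bounded_sorted_paths:
  fixes lt :: "'a \<Rightarrow> 'a \<Rightarrow> bool"
  assumes "transp lt" "irreflp lt" "totalp_on V lt"
    and lin: "linear_order_on {e. e \<subseteq> V \<and> card e = 2} r"
    and dec: "\<And>p. sorted_decreasing_path lt V r p \<Longrightarrow> length p \<le> K"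
    and inc: "\<And>p. sorted_decreasing_path lt V (r\<inverse>) p \<Longrightarrow> length p \<le> K"
  shows "card V \<le> 2 ^ K\<^sup>2"
proof -
  define colour where
    "colour u v = (longest_ending lt V r u v, longest_ending lt V (r\<inverse>) u v)" for u v
  define A where "A v = {colour u v | u. u \<in> V \<and> lt u v}" for v
  have irrefl: "\<not> lt x x" for x
    using assms(2) by (auto dest: irreflpD)
  have neq: "colour u v \<noteq> colour v w"
    if "u \<in> V" "v \<in> V" "w \<in> V" "lt u v" "lt v w" for u v w
  proof -
    \<comment> \<open>This separates \<open>u\<close> from \<open>w\<close>, so the two edges differ
      and are strictly comparable in \<open>r\<close>.\<close>
    have "lt u w" using assms(1) that by (blast dest: transpD)
    then have "{u, v} \<noteq> {v, w}" and "u \<noteq> v" "v \<noteq> w"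
      using irrefl that by (auto simp: doubleton_eq_iff)
    moreover from this have edges: "{u, v} \<in> {e. e \<subseteq> V \<and> card e = 2}" "{v, w} \<in> {e. e \<subseteq> V \<and> card e = 2}"
      using that by auto
    ultimately have "({u, v}, {v, w}) \<in> r - Id \<or> ({u, v}, {v, w}) \<in> r\<inverse> - Id"
      using lin[unfolded linear_order_on_def total_on_def, THEN conjunct2, rule_format, OF edges]
      by auto
    then have "longest_ending lt V r u v < longest_ending lt V r v w \<or>
        longest_ending lt V (r\<inverse>) u v < longest_ending lt V (r\<inverse>) v w"
      using longest_ending_less[where r = r and V = V and lt = lt and K = K, OF dec assms(1) that]
        longest_ending_less[where r = "r\<inverse>" and V = V and lt = lt and K = K, OF inc assms(1) that] by blast
    then show ?thesis unfolding colour_def by auto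
  qed
  have "inj_on A V"
  proof (rule inj_onI, rule ccontr)
    fix x y assume xy: "x \<in> V" "y \<in> V" "A x = A y" "x \<noteq> y"
    have *: "A u \<noteq> A v" if "u \<in> V" "v \<in> V" "lt u v" for u v
    proof
      assume "A u = A v"
      \<comment> \<open>If \<open>A u = A v\<close>, this colour also occurs on an edge from some
        \<open>w\<close> into \<open>u\<close>, which contradicts \<open>neq\<close> for
        \<open>w\<close>, \<open>u\<close>, \<open>v\<close>.\<close>
      moreover have "colour u v \<in> A v" using that unfolding A_def by blast
      ultimately obtain w where "w \<in> V" "lt w u" "colour u v = colour w u"
        unfolding A_def by blast
      with neq[of w u v] that show False by simp
    qed
    with xy assms(3) show False by (metis totalp_onD)
  qed
  moreover have "colour u v \<in> {1..K} \<times> {1..K}" if "u \<in> V" "v \<in> V" "lt u v" for u v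
    unfolding colour_def
    using longest_ending_bounds[where r = r and V = V and lt = lt and K = K, OF dec that]
      longest_ending_bounds[where r = "r\<inverse>" and V = V and lt = lt and K = K, OF inc that]
    by (rule SigmaI)
  then have "A ` V \<subseteq> Pow ({1..K} \<times> {1..K})"
    unfolding A_def by blast
  ultimately have "card V \<le> card (Pow ({1..K} \<times> {1..K}))"
    by (intro card_inj_on_le[of A]) auto
  then show ?thesis by (simp add: card_Pow power2_eq_square)
qed

section \<open>The lexicographic order and non-crossing paths\<close>

text \<open>The second coordinate breaks ties, since general position still allows two points on a
  vertical line.\<close>

definition lex_less :: "point \<Rightarrow> point \<Rightarrow> bool" where
  "lex_less a b \<longleftrightarrow> a $ 1 < b $ 1 \<or> a $ 1 = b $ 1 \<and> a $ 2 < b $ 2"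

lemma transp_lex_less: "transp lex_less"
  by (auto simp: transp_def lex_less_def)

lemma irreflp_lex_less: "irreflp lex_less"
  by (auto simp: irreflp_def lex_less_def)

lemma totalp_lex_less: "totalp lex_less"
  by (auto simp: totalp_on_def lex_less_def vec_eq_iff forall_2)

text \<open>Coordinates that differ are strictly separated by the combination, and a tie in the
  first coordinate persists, so that the second one decides.\<close>

lemma lex_less_convex_combination:
  assumes "lex_less a b" "0 < t" "t < 1"
  shows "lex_less a ((1 - t) *\<^sub>R a + t *\<^sub>R b)" "lex_less ((1 - t) *\<^sub>R a + t *\<^sub>R b) b"
proof -
  have 1: "x < (1 - t) * x + t * y" "(1 - t) * x + t * y < y" if "x < y" for x y :: real
  proof -
    have "0 < t * (y - x)" "0 < (1 - t) * (y - x)" using assms that by auto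
    then show "x < (1 - t) * x + t * y" "(1 - t) * x + t * y < y"
      by (simp_all add: algebra_simps)
  qed
  have 2: "(1 - t) * x + t * x = x" for x :: real by (simp add: algebra_simps)
  show "lex_less a ((1 - t) *\<^sub>R a + t *\<^sub>R b)" "lex_less ((1 - t) *\<^sub>R a + t *\<^sub>R b) b"
    using assms(1) by (auto simp: lex_less_def 1 2)
qed

lemma lex_less_open_segment:
  assumes "lex_less a b" "z \<in> open_segment a b"
  shows "lex_less a z" "lex_less z b"
  using assms lex_less_convex_combination by (auto simp: in_segment)

text \<open>The edges occupy successive intervals of the lexicographic order: a common inner point
  would lie before the right end of the earlier edge and after the left end of the later
  one.\<close>

lemma sorted_imp_noncrossing:
  assumes "sorted_wrt lex_less p"
  shows "noncrossing_path p"
proof -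
  have disj: "open_segment (p ! i) (p ! Suc i) \<inter> open_segment (p ! j) (p ! Suc j) = {}"
    if "i < j" "Suc j < length p" for i j
  proof (rule ccontr)
    assume "\<not> ?thesis"
    then obtain z where z: "z \<in> open_segment (p ! i) (p ! Suc i)"
      "z \<in> open_segment (p ! j) (p ! Suc j)" by blast
    have "lex_less (p ! i) (p ! Suc i)" "lex_less (p ! j) (p ! Suc j)"
      using that by (auto intro: sorted_wrt_nth_less[OF assms])
    then have "lex_less z (p ! Suc i)" "lex_less (p ! j) z"
      using z lex_less_open_segment by blast+
    \<comment> \<open>Adjacent edges share the endpoint \<open>p ! j\<close>, but the strict
      inequalities for \<open>z\<close> suffice in both cases.\<close>
    moreover have "Suc i = j \<or> lex_less (p ! Suc i) (p ! j)"
      using sorted_wrt_nth_less[OF assms, of "Suc i" j] that by linarith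
    ultimately have "lex_less z z"
      using transpD[OF transp_lex_less] by metis
    then show False by (simp add: lex_less_def)
  qed
  have "\<not> edges_cross (path_edge p i) (path_edge p j)"
    if ij: "Suc i < length p" "Suc j < length p" for i j
  proof
    assume "edges_cross (path_edge p i) (path_edge p j)"
    then obtain a b c d where ab: "{p ! i, p ! Suc i} = {a, b}" "{p ! j, p ! Suc j} = {c, d}"
      and ne: "path_edge p i \<noteq> path_edge p j" "open_segment a b \<inter> open_segment c d \<noteq> {}"
      unfolding edges_cross_def path_edge_def by blast
    then have "open_segment (p ! i) (p ! Suc i) \<inter> open_segment (p ! j) (p ! Suc j) \<noteq> {}"
      by (auto simp: doubleton_eq_iff open_segment_commute)
    moreover have "i \<noteq> j" using ne(1) by auto
    ultimately show False
      using disj[of i j] disj[of j i] ij by (auto simp: Int_commute neq_iff)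
  qed
  then show ?thesis unfolding noncrossing_path_def by blast
qed

text \<open>The bound \<open>K\<close> of the counting lemma is taken to be the length of a longest
  sorted path. The exponent counts vertices, one more than the edges of the path.\<close>

lemma exists_noncrossing_monotone_path:
  fixes G :: "point graph"
  assumes "finite (verts G)" "verts G \<noteq> {}"
    and edges: "edges G = {e. e \<subseteq> verts G \<and> card e = 2}"
    and r: "edge_ordering G r"
  obtains p where "noncrossing_monotone_path G r p" "card (verts G) \<le> 2 ^ (length p)\<^sup>2"
proof -
  let ?S = "sorted_decreasing_path lex_less (verts G)"
  have distinct: "distinct p" if "sorted_wrt lex_less p" for p
    unfolding distinct_conv_nth using sorted_wrt_nth_less[OF that] irreflp_lex_less
    by (metis irreflpD neqE)
  have path: "noncrossing_monotone_path G r p" if p: "?S r p \<or> ?S (r\<inverse>) p" "p \<noteq> []" for p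
  proof -
    have sorted: "sorted_wrt lex_less p" "set p \<subseteq> verts G"
      and mono: "monotone_path r p"
      using p by (auto simp: sorted_decreasing_path_def monotone_path_def
          increasing_path_conv_decreasing)
    have "path_edge p i \<in> edges G" if "Suc i < length p" for i
      using that sorted(2) distinct[OF sorted(1)]
      by (auto simp: edges path_edge_def nth_eq_iff_index_eq subset_iff)
    then show ?thesis
      using p(2) sorted distinct mono sorted_imp_noncrossing
      by (auto simp: noncrossing_monotone_path_def is_path_def)
  qed
  \<comment> \<open>Maximising over both directions at once gives one bound for both. The empty list
    is excluded because it is not a path.\<close>
  let ?P = "\<lambda>p. (?S r p \<or> ?S (r\<inverse>) p) \<and> p \<noteq> []"
  obtain v where "v \<in> verts G" using assms(2) by blast
  then have "?P [v]"
    by (simp add: sorted_decreasing_path_def decreasing_path_def)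
  moreover have "length p < Suc (card (verts G))" if "?P p" for p
  proof -
    have "distinct p" "set p \<subseteq> verts G"
      using that distinct by (auto simp: sorted_decreasing_path_def)
    then show ?thesis by (metis assms(1) card_mono distinct_card less_Suc_eq_le)
  qed
  ultimately have "\<exists>p. ?P p \<and> (\<forall>q. ?P q \<longrightarrow> length q \<le> length p)"
    by (rule Lattices_Big.ex_has_greatest_nat[OF _ allI[OF impI]])
  then obtain p where p: "?P p" "\<forall>q. ?P q \<longrightarrow> length q \<le> length p"
    by (rule exE) (erule conjE, rule that)
  have "length q \<le> length p" if "?S r q \<or> ?S (r\<inverse>) q" for q
    using p(2)[rule_format, of q] that by (cases "q = []") auto
  then have "card (verts G) \<le> 2 ^ (length p)\<^sup>2"
    using r unfolding edge_ordering_def edges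
    by (intro card_le_of_bounded_sorted_paths[OF transp_lex_less irreflp_lex_less
          totalp_on_subset[OF totalp_lex_less subset_UNIV], of _ r]) simp_all
  with path p(1) show ?thesis by (intro that) auto
qed

section \<open>Straight-line drawings of complete graphs\<close>

lemma drawing_of_complete_graph:
  assumes "straight_line_drawing G (complete_graph n)"
  shows "finite (verts G)" "card (verts G) = n"
    and "edges G = {e. e \<subseteq> verts G \<and> card e = 2}"
proof -
  obtain f where f: "bij_betw f (verts G) {..<n}"
    and iso: "\<And>u v. u \<in> verts G \<Longrightarrow> v \<in> verts G \<Longrightarrow>
      {u, v} \<in> edges G \<longleftrightarrow> {f u, f v} \<subseteq> {..<n} \<and> card {f u, f v} = 2"
    and simple: "simple_graph G"
    using assms by (auto simp: straight_line_drawing_def geometric_graph_def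
        graph_isomorphic_def complete_graph_def)
  show "finite (verts G)" using simple by (simp add: simple_graph_def)
  show "card (verts G) = n" using bij_betw_same_card[OF f] by simp
  have "e \<in> edges G" if e: "e \<subseteq> verts G" "card e = 2" for e
  proof -
    obtain u v where uv: "e = {u, v}" "u \<noteq> v" using e(2) by (auto simp: card_2_iff)
    then have "f u \<noteq> f v" using f e(1) by (auto simp: bij_betw_def dest: inj_onD)
    then show ?thesis using iso[of u v] uv e(1) f by (auto simp: bij_betw_def)
  qed
  then show "edges G = {e. e \<subseteq> verts G \<and> card e = 2}"
    using simple by (auto simp: simple_graph_def)
qed

text \<open>No line meets a parabola in three points, so these points yield a drawing of every
  complete graph.\<close>

definition parabola_point :: "nat \<Rightarrow> point" where
  "parabola_point i = vector [real i, (real i)\<^sup>2]"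

lemma inj_parabola_point: "inj parabola_point"
  by (rule injI) (simp add: parabola_point_def vec_eq_iff forall_2)

lemma general_position_parabola: "general_position (range parabola_point)"
proof -
  have "\<not> collinear {parabola_point i, parabola_point j, parabola_point k}"
    if "i \<noteq> j" "j \<noteq> k" "i \<noteq> k" for i j k
  proof
    assume "collinear {parabola_point i, parabola_point j, parabola_point k}"
    then obtain u c d where "parabola_point j - parabola_point i = c *\<^sub>R u"
      "parabola_point k - parabola_point i = d *\<^sub>R u"
      unfolding collinear_def by blast
    then have eqs: "real j - real i = c * u $ 1" "(real j)\<^sup>2 - (real i)\<^sup>2 = c * u $ 2"
      "real k - real i = d * u $ 1" "(real k)\<^sup>2 - (real i)\<^sup>2 = d * u $ 2"
      by (simp_all add: parabola_point_def vec_eq_iff forall_2)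
    \<comment> \<open>The left side is the Vandermonde product of \<open>i\<close>,
      \<open>j\<close>, \<open>k\<close>. The right side is the cross product of two differences
      that are multiples of the same \<open>u\<close>, hence zero.\<close>
    have "(real j - real i) * (real k - real i) * (real k - real j) =
      (real j - real i) * ((real k)\<^sup>2 - (real i)\<^sup>2) - ((real j)\<^sup>2 - (real i)\<^sup>2) * (real k - real i)"
      by (simp add: algebra_simps power2_eq_square)
    also have "\<dots> = 0" unfolding eqs by (simp add: algebra_simps)
    finally show False using that by simp
  qed
  then show ?thesis unfolding general_position_def by (metis rangeE)
qed

lemma general_position_subset: "general_position T \<Longrightarrow> S \<subseteq> T \<Longrightarrow> general_position S"
  unfolding general_position_def by (meson subsetD)

lemma exists_drawing_of_complete_graph: "\<exists>G. straight_line_drawing G (complete_graph n)"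
proof -
  let ?V = "parabola_point ` {..<n}"
  let ?G = "\<lparr>verts = ?V, edges = {e. e \<subseteq> ?V \<and> card e = 2}\<rparr>"
  let ?f = "inv parabola_point"
  have "simple_graph ?G" by (auto simp: simple_graph_def)
  moreover have "general_position ?V"
    by (rule general_position_subset[OF general_position_parabola]) auto
  moreover have "graph_isomorphic ?G (complete_graph n)"
    unfolding graph_isomorphic_def complete_graph_def
  proof (intro exI[of _ ?f] conjI)
    show "bij_betw ?f (verts ?G) (verts \<lparr>verts = {..<n}, edges = {e. e \<subseteq> {..<n} \<and> card e = 2}\<rparr>)"
      by (auto simp: bij_betw_def inj_on_def image_image inv_f_f[OF inj_parabola_point])
  qed (auto simp: inv_f_f[OF inj_parabola_point] card_insert_if
        inj_eq[OF inj_parabola_point])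
  ultimately show ?thesis
    unfolding straight_line_drawing_def geometric_graph_def by auto
qed

section \<open>From paths to the asymptotic bound\<close>

text \<open>Both infima range over nonempty sets of naturals and are therefore attained, so a path
  for the optimal drawing and ordering is enough.\<close>

lemma path_length_le_alpha_bar:
  assumes "\<And>G r. straight_line_drawing G (complete_graph n) \<Longrightarrow> edge_ordering G r \<Longrightarrow>
    \<exists>p. noncrossing_monotone_path G r p \<and> m \<le> real (path_length p)"
  shows "m \<le> real (alpha_bar (complete_graph n))"
proof -
  have "alpha_bar (complete_graph n)
      \<in> {alpha_bar_geometric D | D. straight_line_drawing D (complete_graph n)}"
    unfolding alpha_bar_def
    by (rule Inf_nat_def1) (use exists_drawing_of_complete_graph in blast)
  then obtain G where G: "straight_line_drawing G (complete_graph n)"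
    "alpha_bar (complete_graph n) = alpha_bar_geometric G" by blast
  \<comment> \<open>Any well-order of the edges shows that the inner infimum is over a nonempty
    set.\<close>
  obtain r0 where "edge_ordering G r0"
    unfolding edge_ordering_def using well_order_on well_order_on_def by metis
  then have "alpha_bar_geometric G
      \<in> {max_noncrossing_monotone_length G r | r. edge_ordering G r}"
    unfolding alpha_bar_geometric_def by (intro Inf_nat_def1) blast
  then obtain r where r: "edge_ordering G r"
    "alpha_bar_geometric G = max_noncrossing_monotone_length G r" by blast
  obtain p where p: "noncrossing_monotone_path G r p" "m \<le> real (path_length p)"
    using assms[OF G(1) r(1)] by blast
  \<comment> \<open>Needed for finiteness of the set under \<open>Max\<close>.\<close>
  have "path_length q \<le> n" if "noncrossing_monotone_path G r q" for q
  proof -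
    have "distinct q" "set q \<subseteq> verts G"
      using that by (auto simp: noncrossing_monotone_path_def is_path_def)
    then have "length q \<le> n"
      by (metis drawing_of_complete_graph(1,2)[OF G(1)] card_mono distinct_card)
    then show ?thesis by (simp add: path_length_def)
  qed
  then have "finite {path_length q | q. noncrossing_monotone_path G r q}"
    by (auto intro!: rev_finite_subset[of "{..n}"])
  then have "path_length p \<le> max_noncrossing_monotone_length G r"
    unfolding max_noncrossing_monotone_length_def using p(1) by (intro Max_ge) auto
  with p(2) G(2) r(2) show ?thesis by linarith
qed

text \<open>Take logarithms in the counting bound and estimate \<open>ln 2\<close> by 1. The
  subtracted 1 converts vertices to edges.\<close>

lemma noncrossing_monotone_path_sqrt_ln:
  assumes "n > 0" "straight_line_drawing G (complete_graph n)" "edge_ordering G r"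
  obtains p where "noncrossing_monotone_path G r p" "sqrt (ln (real n)) - 1 \<le> real (path_length p)"
proof -
  note G = drawing_of_complete_graph[OF assms(2)]
  have "verts G \<noteq> {}" using G(2) assms(1) by auto
  then obtain p where p: "noncrossing_monotone_path G r p" "n \<le> 2 ^ (length p)\<^sup>2"
    using exists_noncrossing_monotone_path[OF G(1) _ G(3) assms(3)] G(2) by metis
  have "ln (real n) \<le> ln (2 ^ (length p)\<^sup>2)"
    using p(2) assms(1) by (subst ln_le_cancel_iff) (auto simp flip: of_nat_le_iff)
  also have "\<dots> = (real (length p))\<^sup>2 * ln 2" by (simp add: ln_realpow)
  also have "\<dots> \<le> (real (length p))\<^sup>2"
    using ln_2_less_1 by (intro mult_left_le) auto
  finally have "sqrt (ln (real n)) \<le> real (length p)"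
    by (intro real_le_lsqrt) auto
  then have "sqrt (ln (real n)) - 1 \<le> real (path_length p)"
    by (simp add: path_length_def)
  with p(1) that show ?thesis by blast
qed

theorem theorem1:
  "(\<lambda>n. real (alpha_bar (complete_graph n))) \<in> \<Omega>(\<lambda>n. ln (ln (real n))) \<and>
   (\<exists>c>0. \<exists>N. \<forall>n\<ge>N. \<forall>G r.
      straight_line_drawing G (complete_graph n) \<and> edge_ordering G r \<longrightarrow>
      (\<exists>p. noncrossing_monotone_path G r p \<and> real (path_length p) \<ge> c * ln (ln (real n))))"
proof -
  \<comment> \<open>Nonnegativity removes the norm in the Landau estimate below.\<close>
  have "\<forall>\<^sub>F n :: nat in sequentially. 0 \<le> ln (ln (real n))"
    by real_asymp
  moreover have "\<forall>\<^sub>F n :: nat in sequentially. ln (ln (real n)) \<le> sqrt (ln (real n)) - 1"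
    by real_asymp
  ultimately have "\<forall>\<^sub>F n :: nat in sequentially.
      0 \<le> ln (ln (real n)) \<and> ln (ln (real n)) \<le> sqrt (ln (real n)) - 1"
    by (rule eventually_conj)
  then obtain N where N: "\<And>n. n \<ge> N \<Longrightarrow> 0 \<le> ln (ln (real n))"
    "\<And>n. n \<ge> N \<Longrightarrow> ln (ln (real n)) \<le> sqrt (ln (real n)) - 1"
    unfolding eventually_sequentially by blast
  \<comment> \<open>The constant is 1, as \<open>sqrt (ln n) - 1\<close> eventually exceeds
    \<open>ln (ln n)\<close>. The threshold \<open>Suc N\<close> makes \<open>n\<close>
    positive.\<close>
  have path: "\<exists>p. noncrossing_monotone_path G r p \<and> ln (ln (real n)) \<le> real (path_length p)"
    if n: "n \<ge> Suc N" and G: "straight_line_drawing G (complete_graph n)" "edge_ordering G r"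
    for n G r
  proof -
    have "n > 0" "n \<ge> N" using n by auto
    obtain p where p: "noncrossing_monotone_path G r p"
      "sqrt (ln (real n)) - 1 \<le> real (path_length p)"
      using noncrossing_monotone_path_sqrt_ln[OF \<open>n > 0\<close> G] .
    with N(2)[OF \<open>n \<ge> N\<close>] have "ln (ln (real n)) \<le> real (path_length p)" by linarith
    with p(1) show ?thesis by blast
  qed
  have "\<forall>\<^sub>F n in sequentially.
      norm (ln (ln (real n))) \<le> 1 * norm (real (alpha_bar (complete_graph n)))"
    using eventually_ge_at_top[of "Suc N"]
  proof eventually_elim
    case (elim n)
    then show ?case
      using path_length_le_alpha_bar[OF path, of n] N(1)[of n] by simp
  qed
  then have "(\<lambda>n. real (alpha_bar (complete_graph n))) \<in> \<Omega>(\<lambda>n. ln (ln (real n)))"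
    unfolding bigomega_iff_bigo by (rule bigoI)
  with path show ?thesis
    by (intro conjI exI[of _ 1] exI[of _ "Suc N"]) auto
qed

end
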